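(* For every integer $n\ge0$, there is a bijection between the set of leaf-colored doubly rooted plane trees with $n$ edges and the set of free Schröder paths of length $2n$.
   Context: A plane tree is a rooted tree with linearly ordered children; a leaf is a non-root vertex with no children. A doubly rooted plane tree is a plane tree with a distinguished vertex (possibly the root). A leaf-colored doubly rooted plane tree is a doubly rooted plane tree in which every leaf other than the distinguished vertex is colored red or blue (the distinguished vertex receives no color even if it is a leaf). A free Schröder path of length $2n$ is any lattice path from $(0,0)$ to $(2n,0)$ with steps $U=(1,1)$, $H=(2,0)$, $D=(1,-1)$, with no further restriction. *)

theory Defs
  imports Main "HOL-Library.Product_Plus"
begin

datatype plane_tree = Node "plane_tree list"

text \<open>A vertex is represented by its address: the list of child indices followed from the root,
  so that \<open>[]\<close> is the root and \<open>v @ [i]\<close> is the \<open>i\<close>-th child of \<open>v\<close>.\<close>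

function vertices :: "plane_tree \<Rightarrow> nat list set" where
  "vertices (Node ts) = insert [] (\<Union>i\<in>{..<length ts}. (\<lambda>v. i # v) ` vertices (ts ! i))"
  by pat_completeness auto
termination
  by (relation "measure size") (auto intro!: less_Suc_eq_le[THEN iffD2] size_list_estimation' nth_mem)

fun num_edges :: "plane_tree \<Rightarrow> nat" where
  "num_edges (Node ts) = (\<Sum>t\<leftarrow>ts. Suc (num_edges t))"

definition leaves :: "plane_tree \<Rightarrow> nat list set" where
  "leaves t = {v \<in> vertices t. v \<noteq> [] \<and> (\<forall>i. v @ [i] \<notin> vertices t)}"

datatype color = Red | Blue

text \<open>Triples of a plane tree, its distinguished vertex, and the coloring, a partial map
  defined exactly on the leaves that have to be colored.\<close>

definition leaf_colored_doubly_rooted ::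
    "nat \<Rightarrow> (plane_tree \<times> nat list \<times> (nat list \<rightharpoonup> color)) set" where
  "leaf_colored_doubly_rooted n =
     {(t, v, c). num_edges t = n \<and> v \<in> vertices t \<and> dom c = leaves t - {v}}"

datatype step = U | H | D

fun step_vec :: "step \<Rightarrow> int \<times> int" where
  "step_vec U = (1, 1)"
| "step_vec H = (2, 0)"
| "step_vec D = (1, -1)"

text \<open>The parameter \<open>n\<close> is the semilength: the paths run from \<open>(0, 0)\<close> to \<open>(2n, 0)\<close>.
  A path from the origin is determined by its sequence of steps.\<close>

definition free_schroeder_paths :: "nat \<Rightarrow> step list set" where
  "free_schroeder_paths n = {p. sum_list (map step_vec p) = (2 * int n, 0)}"

end

theory Submission
  imports Defs
begin

text \<open>
  A plane forest with red and blue leaves is encoded as a Schroeder path: a red leaf becomes \<open>H\<close>,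
  a blue leaf becomes \<open>UD\<close>, and an inner tree over a nonempty forest \<open>g\<close> becomes \<open>U g D\<close>; so \<open>U g D\<close>
  with \<open>g\<close> possibly empty covers the last two cases at once. Walking from the root of a doubly rooted
  tree to its distinguished vertex, each edge has a forest \<open>l\<close> to its left and a forest \<open>r\<close> to its
  right, and the walk ends with the forest \<open>f\<close> below the distinguished vertex. Writing each edge as
  the path of \<open>l\<close> followed by \<open>D r' U\<close>, where \<open>r'\<close> is the path of \<open>r\<close> reflected in the axis, and
  concluding with the path of \<open>f\<close>, one obtains the unique factorization of a free Schroeder path
  into nonnegative parts separated by strictly negative excursions.
\<close>

text \<open>\<open>Red_Leaf f\<close> puts a red leaf in front of \<open>f\<close>; \<open>Child g f\<close> puts in front of \<open>f\<close> a vertex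
  whose children form \<open>g\<close>, which is a blue leaf if \<open>g\<close> is empty.\<close>

datatype cforest = Empty | Red_Leaf cforest | Child cforest cforest

text \<open>A zipper along the walk to the distinguished vertex, for which no color is stored, even
  when it is childless as in \<open>Here Empty\<close>.\<close>

datatype marked = Here cforest | Down cforest marked cforest

primrec cforest_edges :: "cforest \<Rightarrow> nat" where
  "cforest_edges Empty = 0"
| "cforest_edges (Red_Leaf f) = Suc (cforest_edges f)"
| "cforest_edges (Child g f) = Suc (cforest_edges g + cforest_edges f)"

primrec marked_edges :: "marked \<Rightarrow> nat" where
  "marked_edges (Here f) = cforest_edges f"
| "marked_edges (Down l m r) = Suc (cforest_edges l + marked_edges m + cforest_edges r)"

section \<open>Marked forests and free Schroeder paths\<close>

text \<open>The two steps are parameters because \<open>cforest_path D U\<close> is the reflection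
  of \<open>cforest_path U D\<close> in the axis.\<close>

primrec cforest_path :: "step \<Rightarrow> step \<Rightarrow> cforest \<Rightarrow> step list" where
  "cforest_path a b Empty = []"
| "cforest_path a b (Red_Leaf f) = H # cforest_path a b f"
| "cforest_path a b (Child g f) = a # cforest_path a b g @ b # cforest_path a b f"

primrec marked_path :: "marked \<Rightarrow> step list" where
  "marked_path (Here f) = cforest_path U D f"
| "marked_path (Down l m r) =
     cforest_path U D l @ D # cforest_path D U r @ U # marked_path m"

text \<open>Parsing is deterministic: the next step selects the constructor, and a forest ends at
  the first \<open>b\<close> not matched by an earlier \<open>a\<close>, or at the end of the
  word.\<close>

lemma cforest_path_append_inject:
  assumes "a \<noteq> b" "a \<noteq> H" "b \<noteq> H"
    and "cforest_path a b f @ xs = cforest_path a b f' @ xs'"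
    and "xs = [] \<or> hd xs = b" "xs' = [] \<or> hd xs' = b"
  shows "f = f' \<and> xs = xs'"
  using assms(4-)
proof (induction f arbitrary: f' xs xs')
  case Empty
  then show ?case using assms(1-3) by (cases f') auto
next
  case (Red_Leaf f)
  show ?case
  proof (cases f')
    case eq: (Red_Leaf f2)
    then have "cforest_path a b f @ xs = cforest_path a b f2 @ xs'"
      using Red_Leaf.prems(1) by simp
    then show ?thesis using Red_Leaf.IH Red_Leaf.prems(2,3) eq by blast
  qed (use Red_Leaf.prems assms(1-3) in auto)
next
  case (Child g f)
  show ?case
  proof (cases f')
    case Empty
    then show ?thesis using Child.prems assms(1-3) by auto
  next
    case (Red_Leaf f2)
    then show ?thesis using Child.prems assms(1-3) by auto
  next
    case eq: (Child g2 f2)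
    then have "cforest_path a b g @ b # cforest_path a b f @ xs =
        cforest_path a b g2 @ b # cforest_path a b f2 @ xs'"
      using Child.prems(1) by simp
    from Child.IH(1)[OF this] have "g = g2"
      and *: "cforest_path a b f @ xs = cforest_path a b f2 @ xs'" by simp_all
    then show ?thesis using Child.IH(2)[OF *] Child.prems(2,3) eq by blast
  qed
qed

text \<open>What follows the leading forest tells \<open>Here\<close> (nothing) from
  \<open>Down\<close> (a \<open>D\<close>); the reflected forest then ends at the first unmatched
  \<open>U\<close>.\<close>

lemma inj_marked_path: "inj marked_path"
proof (rule injI)
  show "m = m'" if "marked_path m = marked_path m'" for m m'
    using that
  proof (induction m arbitrary: m')
    case (Here f)
    then show ?case
      using cforest_path_append_inject[of U D f "[]" _ "[]"]
        cforest_path_append_inject[of U D f "[]" _ "D # _"]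
      by (cases m') auto
  next
    case (Down l m r)
    show ?case
    proof (cases m')
      case (Here f)
      then show ?thesis
        using Down.prems[symmetric] cforest_path_append_inject[of U D f "[]" l "D # _"] by auto
    next
      case eq: (Down l' m2 r')
      have "l = l'" and *: "cforest_path D U r @ U # marked_path m = cforest_path D U r' @ U # marked_path m2"
        using Down.prems eq cforest_path_append_inject[of U D l "D # _" l' "D # _"] by auto
      moreover have "r = r'" "marked_path m = marked_path m2"
        using cforest_path_append_inject[OF _ _ _ *] by auto
      ultimately show ?thesis using Down.IH eq by blast
    qed
  qed
qed

section \<open>Endpoints of the paths and surjectivity of the encoding\<close>

abbreviation path_end :: "step list \<Rightarrow> int \<times> int" where
  "path_end p \<equiv> sum_list (map step_vec p)"

lemma path_end_cforest_path:
  assumes "(a, b) = (U, D) \<or> (a, b) = (D, U)"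
  shows "path_end (cforest_path a b f) = (2 * int (cforest_edges f), 0)"
  using assms by (induction f) (auto simp: prod_eq_iff)

lemma path_end_marked_path: "path_end (marked_path m) = (2 * int (marked_edges m), 0)"
  by (induction m) (auto simp: path_end_cforest_path prod_eq_iff)

text \<open>Greedy parsing. The sign \<open>s\<close> makes \<open>a\<close> the upward step in both
  orientations, and the bound on the final height guarantees that each \<open>a\<close> met by the
  parser is closed again.\<close>

lemma cforest_path_factor:
  assumes "(a, b, s) = (U, D, 1) \<or> (a, b, s) = (D, U, -1)" and "s * snd (path_end w) \<le> 0"
  shows "\<exists>f xs. w = cforest_path a b f @ xs \<and> (xs = [] \<or> (\<exists>ys. xs = b # ys))"
  using assms(2)
proof (induction w rule: length_induct)
  case (1 w)
  have ab: "(a, b) = (U, D) \<or> (a, b) = (D, U)" using assms(1) by auto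
  show ?case
  proof (cases w)
    case Nil
    then have "w = cforest_path a b Empty @ []" by simp
    then show ?thesis by blast
  next
    case (Cons x w')
    consider "x = H" | "x = b" | "x = a" using assms(1) by (cases x) auto
    then show ?thesis
    proof cases
      case 1
      then obtain f xs where "w' = cforest_path a b f @ xs" "xs = [] \<or> (\<exists>ys. xs = b # ys)"
        using "1.IH" "1.prems" Cons by fastforce
      then have "w = cforest_path a b (Red_Leaf f) @ xs" using 1 Cons by simp
      then show ?thesis using \<open>xs = [] \<or> _\<close> by blast
    next
      case 2
      then have "w = cforest_path a b Empty @ b # w'" using Cons by simp
      then show ?thesis by blast
    next
      case 3
      have neg: "s * snd (path_end w') < 0"
        using assms(1) "1.prems" Cons 3 by auto
      then obtain g xs where g: "w' = cforest_path a b g @ xs" "xs = [] \<or> (\<exists>ys. xs = b # ys)"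
        using "1.IH" Cons by (metis less_imp_le length_Cons lessI)
      \<comment> \<open>A forest path has height 0, so it cannot exhaust \<open>w'\<close>, whose
        oriented height is negative; hence the matching \<open>b\<close> exists.\<close>
      have "xs \<noteq> []" using g neg path_end_cforest_path[OF ab] by auto
      then obtain ys where ys: "xs = b # ys" using g by blast
      have "s * snd (path_end ys) \<le> 0"
        using "1.prems" assms(1) Cons 3 g ys path_end_cforest_path[OF ab, of g] by auto
      moreover have "length ys < length w" using Cons g ys by simp
      ultimately obtain f zs where
        f: "ys = cforest_path a b f @ zs" "zs = [] \<or> (\<exists>us. zs = b # us)"
        using "1.IH" by blast
      have "w = cforest_path a b (Child g f) @ zs" using Cons 3 g ys f by simp
      then show ?thesis using f by blast
    qed
  qed
qed

text \<open>Split off the maximal nonnegative prefix, then the negative excursion up to its return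
  to the axis, and recurse.\<close>

lemma marked_path_surj:
  assumes "snd (path_end w) = 0"
  shows "\<exists>m. w = marked_path m"
  using assms
proof (induction w rule: length_induct)
  case (1 w)
  obtain l xs where l: "w = cforest_path U D l @ xs" "xs = [] \<or> (\<exists>ys. xs = D # ys)"
    using cforest_path_factor[of U D 1 w] "1.prems" by auto
  show ?case
  proof (cases "xs = []")
    case True
    then have "w = marked_path (Here l)" using l by simp
    then show ?thesis by blast
  next
    case False
    then obtain ys where ys: "xs = D # ys" using l by blast
    \<comment> \<open>From height -1 the rest climbs back to 0, so the reflected factor must be
      followed by a \<open>U\<close>.\<close>
    have up: "snd (path_end ys) = 1"
      using "1.prems" l ys by (simp add: path_end_cforest_path)
    then obtain r zs where r: "ys = cforest_path D U r @ zs" "zs = [] \<or> (\<exists>us. zs = U # us)"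
      using cforest_path_factor[of D U "-1" ys] by auto
    have "zs \<noteq> []" using r up by (auto simp: path_end_cforest_path)
    then obtain us where us: "zs = U # us" using r by blast
    have "snd (path_end us) = 0" using up r us by (simp add: path_end_cforest_path)
    moreover have "length us < length w" using l ys r us by simp
    ultimately obtain m where "us = marked_path m" using "1.IH" by blast
    then have "w = marked_path (Down l m r)" using l ys r us by simp
    then show ?thesis by blast
  qed
qed

lemma bij_betw_marked_path:
  "bij_betw marked_path {m. marked_edges m = n} (free_schroeder_paths n)"
proof (rule bij_betw_imageI)
  show "inj_on marked_path {m. marked_edges m = n}"
    using inj_marked_path by (rule inj_on_subset) simp
  show "marked_path ` {m. marked_edges m = n} = free_schroeder_paths n"
  proof (intro equalityI subsetI)
    fix p assume "p \<in> free_schroeder_paths n"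
    then have p: "path_end p = (2 * int n, 0)" by (simp add: free_schroeder_paths_def)
    then obtain m where "p = marked_path m" using marked_path_surj[of p] by auto
    then show "p \<in> marked_path ` {m. marked_edges m = n}"
      using p by (auto simp: path_end_marked_path)
  qed (auto simp: free_schroeder_paths_def path_end_marked_path)
qed

section \<open>Marked forests and doubly rooted plane trees\<close>

text \<open>Unlike \<open>leaves\<close>, this admits the root: a childless root becomes a leaf once
  its tree is hung below a vertex.\<close>

definition childless :: "plane_tree \<Rightarrow> nat list set" where
  "childless t = {v \<in> vertices t. \<forall>i. v @ [i] \<notin> vertices t}"

lemma Nil_in_vertices [simp]: "[] \<in> vertices t"
  by (cases t) simp

lemma Cons_in_vertices [simp]:
  "i # w \<in> vertices (Node ts) \<longleftrightarrow> i < length ts \<and> w \<in> vertices (ts ! i)"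
  by auto

declare vertices.simps [simp del]

lemma Nil_notin_leaves [simp]: "[] \<notin> leaves t"
  by (simp add: leaves_def)

lemma Cons_in_leaves [simp]:
  "i # w \<in> leaves (Node ts) \<longleftrightarrow> i < length ts \<and> w \<in> childless (ts ! i)"
  by (auto simp: leaves_def childless_def)

lemma leaves_Node_Nil [simp]: "leaves (Node []) = {}"
proof -
  have "v \<notin> leaves (Node [])" for v by (cases v) auto
  then show ?thesis by blast
qed

lemma in_childless_iff: "w \<in> childless t \<longleftrightarrow> w \<in> leaves t \<or> w = [] \<and> t = Node []"
  by (cases t; cases "w = []") (auto simp: childless_def leaves_def)

lemma childless_Node_Nil [simp]: "childless (Node []) = {[]}"
  by (auto simp: in_childless_iff)

lemma childless_Node_nonempty: "ts \<noteq> [] \<Longrightarrow> childless (Node ts) = leaves (Node ts)"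
  by (auto simp: in_childless_iff)

text \<open>The two sets differ only for the one-vertex tree, where \<open>w\<close> is necessarily
  the root.\<close>

lemma childless_minus_vertex:
  assumes "w \<in> vertices t"
  shows "childless t - {w} = leaves t - {w}"
  using assms by (cases t; cases w) (auto simp: in_childless_iff)

text \<open>The coloring of a forest whose first \<open>k\<close> trees are colored by \<open>c\<close> and the others by \<open>d\<close>.\<close>

definition join :: "nat \<Rightarrow> (nat list \<rightharpoonup> color) \<Rightarrow> (nat list \<rightharpoonup> color) \<Rightarrow> (nat list \<rightharpoonup> color)" where
  "join k c d v = (case v of [] \<Rightarrow> None | i # w \<Rightarrow> if i < k then c v else d ((i - k) # w))"

text \<open>The coloring of a one-tree forest, so that \<open>join 1 (graft c) d\<close> puts a tree
  colored by \<open>c\<close> in front of a forest colored by \<open>d\<close>.\<close>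

definition graft :: "(nat list \<rightharpoonup> color) \<Rightarrow> (nat list \<rightharpoonup> color)" where
  "graft c v = (case v of [] \<Rightarrow> None | i # w \<Rightarrow> if i = 0 then c w else None)"

lemma join_simps [simp]:
  "join k c d [] = None"
  "join k c d (i # w) = (if i < k then c (i # w) else d ((i - k) # w))"
  by (simp_all add: join_def)

lemma graft_simps [simp]: "graft c [] = None" "graft c (0 # w) = c w" "graft c (Suc i # w) = None"
  by (simp_all add: graft_def)

text \<open>\<open>join\<close> loses both values at the root and those of \<open>c\<close> from
  index \<open>k\<close> on; the extra hypotheses restore exactly these.\<close>

lemma join_inject:
  assumes "join k c d = join k c' d'" "c [] = c' []" "d [] = d' []"
    and "\<And>i w. k \<le> i \<Longrightarrow> c (i # w) = c' (i # w)"
  shows "c = c'" "d = d'"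
proof -
  have eq: "join k c d v = join k c' d' v" for v using assms(1) by simp
  have "c v = c' v" for v
    using eq[of v] assms(2,4) by (cases v) (auto simp: not_less split: if_splits)
  then show "c = c'" by blast
  have "d v = d' v" for v
  proof (cases v)
    case (Cons i w)
    then show ?thesis using eq[of "(i + k) # w"] by simp
  qed (use assms(3) in simp)
  then show "d = d'" by blast
qed

lemma graft_inject [simp]: "graft c = graft c' \<longleftrightarrow> c = c'"
proof
  assume "graft c = graft c'"
  then have "c w = c' w" for w using graft_simps(2) by metis
  then show "c = c'" by blast
qed simp

lemma join_graft_inject:
  assumes "join 1 (graft c) d = join 1 (graft c') d'" "d [] = d' []"
  shows "c = c'" "d = d'"
  using join_inject[OF assms(1) _ assms(2)] by (auto simp: graft_def)

lemma join_split:
  assumes "c [] = None"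
  shows "join k c (\<lambda>v. case v of [] \<Rightarrow> None | i # w \<Rightarrow> c ((i + k) # w)) = c"
  using assms by (auto simp: join_def fun_eq_iff split: list.splits)

section \<open>Leaf-colored forests as lists of trees\<close>

primrec cforest_trees :: "cforest \<Rightarrow> plane_tree list" where
  "cforest_trees Empty = []"
| "cforest_trees (Red_Leaf f) = Node [] # cforest_trees f"
| "cforest_trees (Child g f) = Node (cforest_trees g) # cforest_trees f"

text \<open>Addresses are taken from a common parent of the trees. For nonempty \<open>g\<close>
  that parent is the \<open>Child\<close> vertex itself, so the coloring of \<open>g\<close> is
  reused; for empty \<open>g\<close> it is a leaf and gets blue.\<close>

primrec cforest_coloring :: "cforest \<Rightarrow> (nat list \<rightharpoonup> color)" where
  "cforest_coloring Empty = Map.empty"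
| "cforest_coloring (Red_Leaf f) = join 1 (graft [[] \<mapsto> Red]) (cforest_coloring f)"
| "cforest_coloring (Child g f) =
     join 1 (graft (if g = Empty then [[] \<mapsto> Blue] else cforest_coloring g)) (cforest_coloring f)"

lemma cforest_trees_eq_Nil [simp]: "cforest_trees f = [] \<longleftrightarrow> f = Empty"
  by (cases f) auto

lemma dom_join_graft:
  assumes "dom c = childless t" "dom d = leaves (Node ts)"
  shows "dom (join 1 (graft c) d) = leaves (Node (t # ts))"
proof (rule set_eqI)
  fix v
  have *: "c w = None \<longleftrightarrow> w \<notin> childless t" "d w = None \<longleftrightarrow> w \<notin> leaves (Node ts)" for w
    using assms by blast+
  show "v \<in> dom (join 1 (graft c) d) \<longleftrightarrow> v \<in> leaves (Node (t # ts))"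
  proof (cases v)
    case (Cons i w)
    then show ?thesis by (cases i) (simp_all add: domIff *)
  qed (simp add: domIff)
qed

lemma dom_cforest_coloring: "dom (cforest_coloring f) = leaves (Node (cforest_trees f))"
proof (induction f)
  case (Child g f)
  have "dom (if g = Empty then [[] \<mapsto> Blue] else cforest_coloring g) =
    childless (Node (cforest_trees g))"
    using Child by (auto simp: childless_Node_nonempty)
  then show ?case using Child dom_join_graft by (simp del: One_nat_def)
qed (simp_all add: dom_join_graft del: One_nat_def)

lemma cforest_coloring_Nil [simp]: "cforest_coloring f [] = None"
  using dom_cforest_coloring[of f] by (metis Nil_notin_leaves domIff)

lemma cforest_coloring_beyond:
  "length (cforest_trees f) \<le> i \<Longrightarrow> cforest_coloring f (i # w) = None"
  using dom_cforest_coloring[of f] by (metis Cons_in_leaves domIff leD)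

text \<open>The tree lists do not separate \<open>Red_Leaf f\<close> from
  \<open>Child Empty f\<close>; the color at the address \<open>[0]\<close> does.\<close>

lemma cforest_trees_coloring_inject:
  assumes "cforest_trees f = cforest_trees f'" "cforest_coloring f = cforest_coloring f'"
  shows "f = f'"
  using assms
proof (induction f arbitrary: f')
  case Empty
  then show ?case by (metis cforest_trees_eq_Nil)
next
  case (Red_Leaf f)
  show ?case
  proof (cases f')
    case (Red_Leaf f2)
    then show ?thesis
      using Red_Leaf.prems Red_Leaf.IH[of f2] by (auto dest: join_graft_inject simp del: One_nat_def)
  next
    case (Child g2 f2)
    then have "g2 = Empty" using Red_Leaf.prems(1) by (auto dest: sym)
    then show ?thesis
      using Red_Leaf.prems(2) Child by (auto dest: fun_cong[of _ _ "[0]"])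
  qed (use Red_Leaf.prems in simp)
next
  case (Child g f)
  show ?case
  proof (cases f')
    case (Red_Leaf f2)
    then have "g = Empty" using Child.prems(1) by auto
    then show ?thesis
      using Child.prems(2) Red_Leaf by (auto dest: fun_cong[of _ _ "[0]"])
  next
    case eq: (Child g2 f2)
    have trees: "cforest_trees g = cforest_trees g2" "cforest_trees f = cforest_trees f2"
      using Child.prems(1) eq by auto
    then have "g = Empty \<longleftrightarrow> g2 = Empty" by (metis cforest_trees_eq_Nil)
    moreover have "cforest_coloring f = cforest_coloring f2"
      and "(if g = Empty then [[] \<mapsto> Blue] else cforest_coloring g) =
        (if g2 = Empty then [[] \<mapsto> Blue] else cforest_coloring g2)"
      using join_graft_inject[OF Child.prems(2)[unfolded eq cforest_coloring.simps]] by simp_all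
    ultimately show ?thesis
      using trees Child.IH eq by (cases "g = Empty") auto
  qed (use Child.prems in simp)
qed

text \<open>Induction on edges covers both recursive calls: the children of the first tree and the
  remaining trees.\<close>

lemma cforest_surj:
  assumes "dom c = leaves (Node ts)"
  shows "\<exists>f. cforest_trees f = ts \<and> cforest_coloring f = c"
  using assms
proof (induction "num_edges (Node ts)" arbitrary: ts c rule: less_induct)
  case less
  have iff: "c v = None \<longleftrightarrow> v \<notin> leaves (Node ts)" for v using less.prems by blast
  show ?case
  proof (cases ts)
    case Nil
    then show ?thesis using less.prems by (intro exI[of _ Empty]) auto
  next
    case (Cons t us)
    define c0 where "c0 = (\<lambda>w. c (0 # w))"
    define c1 where "c1 = (\<lambda>v. case v of [] \<Rightarrow> None | i # w \<Rightarrow> c ((i + 1) # w))"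
    have "c = join 1 c c1"
      unfolding c1_def using iff by (subst join_split) auto
    also have "\<dots> = join 1 (graft c0) c1"
      by (auto simp: join_def graft_def c0_def fun_eq_iff split: list.splits)
    finally have c: "c = join 1 (graft c0) c1" .
    have c0: "dom c0 = childless t"
      unfolding c0_def using iff Cons by (auto simp: dom_def)
    have "dom c1 = leaves (Node us)"
    proof (rule set_eqI)
      show "v \<in> dom c1 \<longleftrightarrow> v \<in> leaves (Node us)" for v
        using iff Cons by (cases v) (auto simp: c1_def domIff)
    qed
    then obtain f where f: "cforest_trees f = us" "cforest_coloring f = c1"
      using less.hyps[of us c1] Cons by auto
    obtain xs where t: "t = Node xs" by (cases t)
    show ?thesis
    proof (cases "xs = []")
      case True
      then have "dom c0 = {[]}" using c0 t by simp
      then obtain x where x: "c0 = [[] \<mapsto> x]" using dom_eq_singleton_conv[of c0 "[]"] by auto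
      show ?thesis
      proof (cases x)
        case Red
        then show ?thesis using c x f t Cons True by (intro exI[of _ "Red_Leaf f"]) simp
      next
        case Blue
        then show ?thesis using c x f t Cons True by (intro exI[of _ "Child Empty f"]) simp
      qed
    next
      case False
      then have "dom c0 = leaves (Node xs)" using c0 t by (simp add: childless_Node_nonempty)
      then obtain g where g: "cforest_trees g = xs" "cforest_coloring g = c0"
        using less.hyps[of xs c0] Cons t by auto
      moreover have "g \<noteq> Empty" using g(1) False by auto
      ultimately show ?thesis
        using c f t Cons by (intro exI[of _ "Child g f"]) simp
    qed
  qed
qed

section \<open>Leaf-colored doubly rooted trees from marked forests\<close>

primrec marked_tree :: "marked \<Rightarrow> plane_tree" where
  "marked_tree (Here f) = Node (cforest_trees f)"
| "marked_tree (Down l m r) = Node (cforest_trees l @ marked_tree m # cforest_trees r)"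

primrec marked_vertex :: "marked \<Rightarrow> nat list" where
  "marked_vertex (Here f) = []"
| "marked_vertex (Down l m r) = length (cforest_trees l) # marked_vertex m"

primrec marked_coloring :: "marked \<Rightarrow> (nat list \<rightharpoonup> color)" where
  "marked_coloring (Here f) = cforest_coloring f"
| "marked_coloring (Down l m r) =
     join (length (cforest_trees l)) (cforest_coloring l)
       (join 1 (graft (marked_coloring m)) (cforest_coloring r))"

lemma num_edges_cforest_trees: "num_edges (Node (cforest_trees f)) = cforest_edges f"
  by (induction f) auto

lemma num_edges_marked_tree: "num_edges (marked_tree m) = marked_edges m"
proof (induction m)
  case (Down l m r)
  then show ?case
    using num_edges_cforest_trees[of l] num_edges_cforest_trees[of r] by simp
qed (simp only: marked_tree.simps marked_edges.simps num_edges_cforest_trees)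

lemma marked_vertex_in_vertices: "marked_vertex m \<in> vertices (marked_tree m)"
  by (induction m) auto

lemma dom_marked_coloring:
  "dom (marked_coloring m) = leaves (marked_tree m) - {marked_vertex m}"
proof (induction m)
  case (Here f)
  then show ?case by (simp add: dom_cforest_coloring)
next
  case (Down l m r)
  \<comment> \<open>Below a new root the childless vertices of the subtree count as leaves, which
    makes no difference once the distinguished vertex is removed.\<close>
  have m: "marked_coloring m w = None \<longleftrightarrow> w \<notin> childless (marked_tree m) - {marked_vertex m}" for w
    using Down childless_minus_vertex[OF marked_vertex_in_vertices] by blast
  have f: "cforest_coloring f v = None \<longleftrightarrow> v \<notin> leaves (Node (cforest_trees f))" for f v
    using dom_cforest_coloring by blast
  show ?case
  proof (rule set_eqI)
    fix v
    show "v \<in> dom (marked_coloring (Down l m r)) \<longleftrightarrow>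
        v \<in> leaves (marked_tree (Down l m r)) - {marked_vertex (Down l m r)}"
    proof (cases v)
      case (Cons i w)
      consider "i < length (cforest_trees l)" | "i = length (cforest_trees l)"
        | j where "i = length (cforest_trees l) + Suc j"
        by (metis less_imp_Suc_add linorder_neqE_nat add_Suc_right)
      then show ?thesis
        by cases (simp_all add: Cons domIff f m nth_append)
    qed (simp add: domIff)
  qed
qed

text \<open>The address of the distinguished vertex separates \<open>Here\<close> from
  \<open>Down\<close> and gives the number of trees in \<open>l\<close>, so children and coloring
  are cut at the same place.\<close>

lemma marked_inject:
  assumes "marked_tree m = marked_tree m'" "marked_vertex m = marked_vertex m'"
    and "marked_coloring m = marked_coloring m'"
  shows "m = m'"
  using assms
proof (induction m arbitrary: m')
  case (Here f)
  then show ?case by (cases m') (auto intro: cforest_trees_coloring_inject)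
next
  case (Down l m r)
  then obtain l' m2 r' where m': "m' = Down l' m2 r'" by (cases m') auto
  have len: "length (cforest_trees l) = length (cforest_trees l')"
    using Down.prems(2) m' by simp
  then have trees: "cforest_trees l = cforest_trees l'" "marked_tree m = marked_tree m2"
    "cforest_trees r = cforest_trees r'"
    using Down.prems(1) m' by auto
  have "cforest_coloring l = cforest_coloring l'"
    and *: "join 1 (graft (marked_coloring m)) (cforest_coloring r) =
      join 1 (graft (marked_coloring m2)) (cforest_coloring r')"
    using join_inject[OF Down.prems(3)[unfolded m' marked_coloring.simps len]] len
    by (simp_all add: cforest_coloring_beyond)
  moreover have "marked_coloring m = marked_coloring m2" "cforest_coloring r = cforest_coloring r'"
    using join_graft_inject[OF *] by simp_all
  ultimately show ?case
    using trees Down.IH Down.prems(2) m' by (simp add: cforest_trees_coloring_inject)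
qed

text \<open>Along the address, each index \<open>k\<close> cuts children and coloring into a left
  part, the subtree entered and a right part.\<close>

lemma marked_surj:
  assumes "v \<in> vertices t" "dom c = leaves t - {v}"
  shows "\<exists>m. marked_tree m = t \<and> marked_vertex m = v \<and> marked_coloring m = c"
  using assms
proof (induction v arbitrary: t c)
  case Nil
  obtain ts where t: "t = Node ts" by (cases t)
  then have "dom c = leaves (Node ts)" using Nil by simp
  then obtain f where "cforest_trees f = ts" "cforest_coloring f = c"
    using cforest_surj by blast
  then show ?case using t by (intro exI[of _ "Here f"]) simp
next
  case (Cons k v)
  obtain ts where t: "t = Node ts" by (cases t)
  have k: "k < length ts" and v: "v \<in> vertices (ts ! k)" using Cons.prems t by auto
  have iff: "c w = None \<longleftrightarrow> w \<notin> leaves (Node ts) - {k # v}" for w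
    using Cons.prems t by blast
  \<comment> \<open>\<open>cl\<close> must vanish from index \<open>k\<close> on for its domain to
    be the leaves of \<open>Node (take k ts)\<close>; \<open>cr\<close> is shifted by
    \<open>Suc k\<close> because child \<open>k\<close> belongs to \<open>cm\<close>.\<close>
  define cl where "cl = (\<lambda>w. case w of [] \<Rightarrow> None | i # _ \<Rightarrow> if i < k then c w else None)"
  define cm where "cm = (\<lambda>w. c (k # w))"
  define cr where "cr = (\<lambda>w. case w of [] \<Rightarrow> None | i # u \<Rightarrow> c ((i + Suc k) # u))"
  have "dom cl = leaves (Node (take k ts))"
  proof (rule set_eqI)
    show "w \<in> dom cl \<longleftrightarrow> w \<in> leaves (Node (take k ts))" for w
      using k by (cases w) (auto simp: cl_def domIff iff simp del: not_None_eq)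
  qed
  then obtain l where l: "cforest_trees l = take k ts" "cforest_coloring l = cl"
    using cforest_surj by blast
  have "dom cr = leaves (Node (drop (Suc k) ts))"
  proof (rule set_eqI)
    show "w \<in> dom cr \<longleftrightarrow> w \<in> leaves (Node (drop (Suc k) ts))" for w
      using k by (cases w) (auto simp: cr_def domIff iff add.commute simp del: not_None_eq)
  qed
  then obtain r where r: "cforest_trees r = drop (Suc k) ts" "cforest_coloring r = cr"
    using cforest_surj by blast
  have "dom cm = childless (ts ! k) - {v}"
    using k by (intro set_eqI) (simp add: cm_def domIff iff del: not_None_eq)
  then have "dom cm = leaves (ts ! k) - {v}" using childless_minus_vertex[OF v] by simp
  then obtain m where m: "marked_tree m = ts ! k" "marked_vertex m = v" "marked_coloring m = cm"
    using Cons.IH[OF v] by blast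
  have "join k cl (join 1 (graft cm) cr) w = c w" for w
  proof (cases w)
    case (Cons i u)
    consider "i < k" | "i = k" | j where "i = k + Suc j"
      by (metis less_imp_Suc_add linorder_neqE_nat add_Suc_right)
    then show ?thesis
      by cases (simp_all add: Cons cl_def cm_def cr_def add.commute)
  qed (use iff[of "[]"] in simp)
  then have "join k cl (join 1 (graft cm) cr) = c" by blast
  then show ?case
    using k l m r t by (intro exI[of _ "Down l m r"]) (simp add: id_take_nth_drop[symmetric] min_def)
qed

lemma bij_betw_marked_tree:
  "bij_betw (\<lambda>m. (marked_tree m, marked_vertex m, marked_coloring m))
     {m. marked_edges m = n} (leaf_colored_doubly_rooted n)"
proof (rule bij_betw_imageI)
  show "inj_on (\<lambda>m. (marked_tree m, marked_vertex m, marked_coloring m)) {m. marked_edges m = n}"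
    by (auto intro!: inj_onI marked_inject)
  show "(\<lambda>m. (marked_tree m, marked_vertex m, marked_coloring m)) ` {m. marked_edges m = n} =
      leaf_colored_doubly_rooted n"
  proof (intro equalityI subsetI)
    fix x assume "x \<in> leaf_colored_doubly_rooted n"
    then obtain t v c where x: "x = (t, v, c)" "num_edges t = n" "v \<in> vertices t"
      "dom c = leaves t - {v}"
      by (auto simp: leaf_colored_doubly_rooted_def)
    then obtain m where "marked_tree m = t" "marked_vertex m = v" "marked_coloring m = c"
      using marked_surj by blast
    then show "x \<in> (\<lambda>m. (marked_tree m, marked_vertex m, marked_coloring m)) ` {m. marked_edges m = n}"
      using x num_edges_marked_tree[of m] by auto
  next
    fix x
    assume "x \<in> (\<lambda>m. (marked_tree m, marked_vertex m, marked_coloring m)) ` {m. marked_edges m = n}"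
    then show "x \<in> leaf_colored_doubly_rooted n"
      by (clarsimp simp: leaf_colored_doubly_rooted_def num_edges_marked_tree
          marked_vertex_in_vertices dom_marked_coloring)
  qed
qed

theorem theorem3p6:
  fixes n :: nat
  shows "\<exists>f. bij_betw f (leaf_colored_doubly_rooted n) (free_schroeder_paths n)"
  using bij_betw_trans[OF bij_betw_inv_into[OF bij_betw_marked_tree] bij_betw_marked_path]
  by blast

end
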